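(* Let $k\ge1$, $n\ge 1$, and let $\boldsymbol{\lambda}=(\lambda^{(0)},\dots,\lambda^{(k-1)})$ and $\boldsymbol{\rho}=(\rho^{(0)},\dots,\rho^{(k-1)})$ be colored partitions of $n$. For any fixed color $j\in\{0,\dots,k-1\}$, the irreducible character value of $C_k\wr S_n$ is given by $$\chi^{\boldsymbol{\lambda}}_{\boldsymbol{\rho}}=\sum_{\substack{\boldsymbol{\mu}\vartriangleleft\boldsymbol{\rho},\ \|\boldsymbol{\mu}\|\ge\lambda^{(j)}_1\\ \boldsymbol{\tau}\vdash\|\boldsymbol{\mu}\|-\lambda^{(j)}_1}}\omega^{(\eta(\boldsymbol{\tau})-\eta(\boldsymbol{\mu}))j}\,\frac{(-1)^{l(\boldsymbol{\tau})}}{k^{l(\boldsymbol{\tau})}z_\tau}\,\chi^{\boldsymbol{\lambda}\setminus\lambda^{(j)}_1}_{(\boldsymbol{\rho}\setminus\boldsymbol{\mu})\cup\boldsymbol{\tau}}.$$ Here the sum over $\boldsymbol{\mu}$ runs over all colored subpartitions $\boldsymbol{\mu}\vartriangleleft\boldsymbol{\rho}$ of weight at least $\lambda^{(j)}_1$, one term for each of the subsets of the set of (positions of) parts of $\boldsymbol{\rho}$. The sum over $\boldsymbol{\tau}$ runs over all partitions $\tau$ of $\|\boldsymbol{\mu}\|-\lambda^{(j)}_1$ and all $k^{l(\tau)}$ maps $\{1,\dots,l(\tau)\}\to\{0,\dots,k-1\}$ painting the parts of $\tau$, with $\boldsymbol{\tau}$ the resulting colored partition (so that a colored partition arising from several paintings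 is counted that many times).
   Context: Fix $k\ge1$, $\omega=e^{2\pi i/k}$ and $I=\{0,1,\dots,k-1\}$. A colored partition of $n$ is a $k$-tuple $\boldsymbol{\lambda}=(\lambda^{(0)},\dots,\lambda^{(k-1)})$ of (possibly empty) partitions, called its constituents, with weight $\|\boldsymbol{\lambda}\|=\sum_i|\lambda^{(i)}|=n$. Let $C_k=\langle c\rangle$ be cyclic of order $k$ and $C_k\wr S_n=C_k^n\rtimes S_n$, with product $(g;\sigma)(h;\tau)=(g\sigma(h);\sigma\tau)$. The conjugacy class of $(g;\sigma)$ is of type $\boldsymbol{\rho}$, where the parts of $\rho^{(i)}$ are the lengths of those cycles of $\sigma$ whose cycle product is $c^i$. Irreducible characters $\chi^{\boldsymbol{\lambda}}$ are indexed by colored partitions of $n$, and $\chi^{\boldsymbol{\lambda}}_{\boldsymbol{\rho}}$ is the value at the class of type $\boldsymbol{\rho}$, with the following normalization. Let $V$ be the complex polynomial algebra in variables $a_{-jr}$ ($j\in I$, $r\ge1$), with the bilinear form for which the monomials $\prod_{j}\prod_t a_{-j\mu^{(j)}_t}$ ($\boldsymbol\mu$ a colored partition) are orthogonal with squared norm $\prod_j z_{\mu^{(j)}}$, where $z_\mu=\prod_i i^{m_i}m_i!$ for $\mu=(1^{m_1}2^{m_2}\cdots)$. Let $s_{j\lambda}$ be the Schur function $s_\lambda$ written as a polynomial in power sums $p_r$, with $p_r$ replaced by $a_{-jr}$; put $s_{\boldsymbol{\lambda}}=\prod_j s_{j\lambda^{(j)}}$, $\widetilde a_{-ir}=\sum_{j\in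 I}\omega^{-ij}a_{-jr}$ and $\widetilde a_{-\boldsymbol{\rho}}=\prod_i\prod_t\widetilde a_{-i\rho^{(i)}_t}$. Then (a known theorem) $\chi^{\boldsymbol{\lambda}}_{\boldsymbol{\rho}}=\langle s_{\boldsymbol{\lambda}},\widetilde a_{-\boldsymbol{\rho}}\rangle$, which may be taken as the definition. In particular, for $n=1$ the character with the box in color $j$ takes the value $\omega^{-ij}$ at $c^i$; for $n=0$ the value is $1$. For a partition $\rho=(\rho_1,\dots,\rho_l)$, a subpartition $\mu\vartriangleleft\rho$ is $\mu=\emptyset$ or $\mu=(\rho_{i_1},\dots,\rho_{i_s})$ with $1\le i_1<\dots<i_s\le l$ (there are $2^{l}$ of them, indexed by subsets of positions), and $\rho\setminus\mu$ is the partition formed by the remaining parts. For colored partitions, $\boldsymbol{\mu}\vartriangleleft\boldsymbol{\rho}$ means $\mu^{(i)}\vartriangleleft\rho^{(i)}$ for every $i$, and $\boldsymbol{\rho}\setminus\boldsymbol{\mu}$ is taken constituentwise. $\mu\cup\tau$ is the partition whose parts are the parts of $\mu$ and $\tau$ together, and $\boldsymbol{\mu}\cup\boldsymbol{\tau}=(\mu^{(i)}\cup\tau^{(i)})_i$. Length: $l(\boldsymbol{\tau})=\sum_i l(\tau^{(i)})$; weighted length: $\eta(\boldsymbol{\tau})=\sum_{i}i\,l(\tau^{(i)})$. The rearrangement $\tau$ of $\boldsymbol{\tau}$ is the ordinary partition obtained by forgetting colors. $\boldsymbol{\lambda}\setminus\lambda^{(j)}_1$ is obtained from $\boldsymbol{\lambda}$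 by deleting the largest part $\lambda^{(j)}_1$ of $\lambda^{(j)}$; if $\lambda^{(j)}=\emptyset$ then $\lambda^{(j)}_1=0$ and nothing is deleted. *)

theory Defs
  imports
    Complex_Main
    "HOL-Library.FuncSet"
    "HOL-Library.Poly_Mapping"
    "Jordan_Normal_Form.Determinant"
begin

definition is_partition :: "nat list \<Rightarrow> bool" where
  "is_partition \<mu> \<longleftrightarrow> sorted_wrt (\<ge>) \<mu> \<and> 0 \<notin> set \<mu>"

definition partitions :: "nat \<Rightarrow> nat list set" where
  "partitions n = {\<mu>. is_partition \<mu> \<and> sum_list \<mu> = n}"

definition z_part :: "nat list \<Rightarrow> nat" where
  "z_part \<mu> = (\<Prod>i\<in>set \<mu>. i ^ count_list \<mu> i * fact (count_list \<mu> i))"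

text \<open>A tuple of \<open>k\<close> constituents is a function on the colors; only its values at the
  colors \<open>0, \<dots>, k - 1\<close> are ever used.\<close>

type_synonym cpart = "nat \<Rightarrow> nat list"

definition weight :: "nat \<Rightarrow> cpart \<Rightarrow> nat" where
  "weight k lam = (\<Sum>i<k. sum_list (lam i))"

definition is_cpart :: "nat \<Rightarrow> nat \<Rightarrow> cpart \<Rightarrow> bool" where
  "is_cpart k n lam \<longleftrightarrow> (\<forall>i<k. is_partition (lam i)) \<and> weight k lam = n"

definition clength :: "nat \<Rightarrow> cpart \<Rightarrow> nat" where
  "clength k \<tau> = (\<Sum>i<k. length (\<tau> i))"

definition \<eta> :: "nat \<Rightarrow> cpart \<Rightarrow> nat" where
  "\<eta> k \<tau> = (\<Sum>i<k. i * length (\<tau> i))"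

definition first_part :: "nat list \<Rightarrow> nat" where
  "first_part \<mu> = (case \<mu> of [] \<Rightarrow> 0 | m # _ \<Rightarrow> m)"

definition delete_first :: "cpart \<Rightarrow> nat \<Rightarrow> cpart" where
  "delete_first lam j = lam(j := tl (lam j))"

definition cunion :: "cpart \<Rightarrow> cpart \<Rightarrow> cpart" where
  "cunion \<mu> \<tau> = (\<lambda>i. rev (sort (\<mu> i @ \<tau> i)))"

text \<open>Colored subpartitions are indexed by sets \<open>A\<close> of positions \<open>(i, t)\<close>, the pair
  standing for the part \<open>\<rho> i ! t\<close>.\<close>

definition positions :: "nat \<Rightarrow> cpart \<Rightarrow> (nat \<times> nat) set" where
  "positions k \<rho> = (SIGMA i:{..<k}. {..<length (\<rho> i)})"

definition csub :: "cpart \<Rightarrow> (nat \<times> nat) set \<Rightarrow> cpart" where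
  "csub \<rho> A = (\<lambda>i. nths (\<rho> i) {t. (i, t) \<in> A})"

definition cdiff :: "cpart \<Rightarrow> (nat \<times> nat) set \<Rightarrow> cpart" where
  "cdiff \<rho> A = (\<lambda>i. nths (\<rho> i) {t. (i, t) \<notin> A})"

definition paintings :: "nat \<Rightarrow> nat list \<Rightarrow> (nat \<Rightarrow> nat) set" where
  "paintings k \<tau> = {..<length \<tau>} \<rightarrow>\<^sub>E {..<k}"

definition paint :: "nat list \<Rightarrow> (nat \<Rightarrow> nat) \<Rightarrow> cpart" where
  "paint \<tau> c = (\<lambda>i. nths \<tau> {t. c t = i})"

text \<open>Complex polynomials in variables indexed by pairs \<open>(j, r)\<close>, where \<open>(j, r)\<close> stands for
  \<open>a\<^bsub>-jr\<^esub>\<close>. A monomial is an exponent function of finite support. The type also contains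
  variables with \<open>j \<ge> k\<close> or \<open>r = 0\<close>; they occur in none of the polynomials below.\<close>

type_synonym monom = "(nat \<times> nat) \<Rightarrow>\<^sub>0 nat"
type_synonym V = "monom \<Rightarrow>\<^sub>0 complex"

definition const :: "complex \<Rightarrow> V" where
  "const c = Poly_Mapping.single 0 c"

definition avar :: "nat \<Rightarrow> nat \<Rightarrow> V" where
  "avar j r = Poly_Mapping.single (Poly_Mapping.single (j, r) 1) 1"

text \<open>The monomial given by a colored partition \<open>\<mu>\<close> has as exponent of \<open>a\<^bsub>-jr\<^esub>\<close> the
  multiplicity of \<open>r\<close> in \<open>\<mu> j\<close>, so the following is the product over \<open>j\<close> of \<open>z_part (\<mu> j)\<close>.\<close>

definition sqnorm :: "monom \<Rightarrow> nat" where
  "sqnorm m = (\<Prod>v\<in>Poly_Mapping.keys m.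
     snd v ^ Poly_Mapping.lookup m v * fact (Poly_Mapping.lookup m v))"

definition form :: "V \<Rightarrow> V \<Rightarrow> complex" where
  "form f g = (\<Sum>m\<in>Poly_Mapping.keys f.
     Poly_Mapping.lookup f m * Poly_Mapping.lookup g m * of_nat (sqnorm m))"

text \<open>Throughout, \<open>p r\<close> is the element substituted for the \<open>r\<close>-th power sum. The complete
  homogeneous symmetric function of degree \<open>n\<close> is the sum of \<open>p\<^sub>\<mu> / z_part \<mu>\<close> over the
  partitions \<open>\<mu>\<close> of \<open>n\<close> (and \<open>0\<close> for negative \<open>n\<close>); Schur functions are the
  Jacobi--Trudi determinants of these.\<close>

definition hom_sym :: "(nat \<Rightarrow> V) \<Rightarrow> int \<Rightarrow> V" where
  "hom_sym p n = (if n < 0 then 0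
     else (\<Sum>\<mu>\<in>partitions (nat n). const (1 / of_nat (z_part \<mu>)) * prod_list (map p \<mu>)))"

definition schur :: "(nat \<Rightarrow> V) \<Rightarrow> nat list \<Rightarrow> V" where
  "schur p lam = det (mat (length lam) (length lam)
     (\<lambda>(s, t). hom_sym p (int (lam ! s) - int s + int t)))"

definition \<omega> :: "nat \<Rightarrow> complex" where
  "\<omega> k = exp (2 * of_real pi * \<i> / of_nat k)"

definition schur_colored :: "nat \<Rightarrow> cpart \<Rightarrow> V" where
  "schur_colored k lam = (\<Prod>j<k. schur (avar j) (lam j))"

definition a_tilde :: "nat \<Rightarrow> nat \<Rightarrow> nat \<Rightarrow> V" where
  "a_tilde k i r = (\<Sum>j<k. const (\<omega> k powi (- (int i * int j))) * avar j r)"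

definition a_tilde_colored :: "nat \<Rightarrow> cpart \<Rightarrow> V" where
  "a_tilde_colored k \<rho> = (\<Prod>i<k. prod_list (map (a_tilde k i) (\<rho> i)))"

text \<open>By a known theorem this pairing is the value, at the class of type \<open>\<rho>\<close>, of the
  irreducible character indexed by \<open>lam\<close> of the wreath product of a cyclic group of order
  \<open>k\<close> with a symmetric group; it is taken here as the definition.\<close>

definition \<chi> :: "nat \<Rightarrow> cpart \<Rightarrow> cpart \<Rightarrow> complex" where
  "\<chi> k lam \<rho> = form (schur_colored k lam) (a_tilde_colored k \<rho>)"

end

theory Submission
  imports Defs "HOL-Computational_Algebra.Formal_Power_Series"
begin

text \<open>Expanding the Jacobi--Trudi determinant along its first row gives Bernstein's formula
  \<open>s\<^sub>\<lambda> = \<Sum>\<^sub>i (-1)\<^sup>i h\<^bsub>m+i\<^esub> e\<^sub>i\<^sup>\<bottom> s\<^sub>\<mu>\<close>, where \<open>m\<close> is the first part of \<open>\<lambda>\<close>, \<open>\<mu>\<close> consists of the other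
  parts, and \<open>f\<^sup>\<bottom>\<close> is the adjoint of multiplication by \<open>f\<close>. Applied in the variables of color
  \<open>j\<close> and paired with \<open>a_tilde_colored k \<rho>\<close>, it moves \<open>h\<^bsub>m+i\<^esub>\<close> to the right-hand side of the form as
  \<open>h\<^bsub>m+i\<^esub>\<^sup>\<bottom>\<close> and \<open>e\<^sub>i\<^sup>\<bottom>\<close> as a factor \<open>e\<^sub>i\<close>. The generating series of the \<open>h\<^sub>n\<^sup>\<bottom>\<close> is the ring
  homomorphism that replaces \<open>a\<^bsub>-jr\<^esub>\<close> by \<open>a\<^bsub>-jr\<^esub> + u\<^sup>r\<close>; it adds \<open>\<omega>\<^bsup>-ij\<^esup> u\<^sup>r\<close> to the factor of a part \<open>r\<close>
  of color \<open>i\<close>, and expanding the product yields the sum over subpartitions. The sum over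
  paintings is \<open>(-1)\<^sup>i e\<^sub>i\<close>, since orthogonality of the characters of the cyclic group recovers
  \<open>a\<^bsub>-jr\<^esub>\<close> from the \<open>a_tilde k i r\<close>.\<close>

subsection \<open>The bilinear form and its adjoint derivations\<close>

text \<open>Inserting a fresh key amounts to adding a single term, so additive identities on
  \<open>V\<close> need to be checked on monomials only.\<close>

lemma poly_mapping_induct_single [case_names zero single add]:
  fixes f :: "'a \<Rightarrow>\<^sub>0 'b::monoid_add"
  assumes "P 0" and "\<And>m c. P (Poly_Mapping.single m c)"
    and "\<And>f g. P f \<Longrightarrow> P g \<Longrightarrow> P (f + g)"
  shows "P f"
proof (induction f rule: update_induct)
  case const
  then show ?case by (rule assms(1))
next
  case (update f a b)
  have "Poly_Mapping.update a b f = f + Poly_Mapping.single a b"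
    using update by (intro poly_mapping_eqI)
      (auto simp: lookup_update lookup_add lookup_single in_keys_iff when_def)
  then show ?case using update assms by simp
qed

lemma const_0 [simp]: "const 0 = 0"
  and const_1 [simp]: "const 1 = 1"
  and const_add: "const (a + b) = const a + const b"
  and const_mult: "const (a * b) = const a * const b"
  and const_uminus: "const (- a) = - const a"
  by (simp_all add: const_def single_add mult_single single_uminus)

lemma const_of_nat: "const (of_nat n) = of_nat n"
  by (simp add: const_def)

lemma const_sum: "const (sum f A) = (\<Sum>x\<in>A. const (f x))"
  by (induction A rule: infinite_finite_induct) (simp_all add: const_add)

lemma const_prod: "const (prod f A) = (\<Prod>x\<in>A. const (f x))"
  by (induction A rule: infinite_finite_induct) (simp_all add: const_mult)

lemma const_inverse_of_nat: "n > 0 \<Longrightarrow> const (c / of_nat n) * of_nat n = const c"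
  by (simp flip: const_of_nat const_mult)

text \<open>\<open>V\<close> is not a field, but positive integers are units in it. The recursions
  below determine \<open>n\<close> times an element, and this cancels \<open>n\<close>.\<close>

lemma of_nat_V_cancel:
  fixes x y :: V
  assumes "n > 0" and "of_nat n * x = of_nat n * y"
  shows "x = y"
proof -
  have "const (1 / of_nat n) * (of_nat n * x) = const (1 / of_nat n) * (of_nat n * y)"
    using assms(2) by simp
  then show ?thesis
    using assms(1) by (simp flip: mult.assoc add: const_inverse_of_nat)
qed

text \<open>Summing over a common finite set of monomials removes the dependence of the index set on
  the first argument; symmetry and additivity follow.\<close>

lemma form_supset:
  assumes "finite S" and "Poly_Mapping.keys f \<subseteq> S"
  shows "form f g = (\<Sum>m\<in>S. Poly_Mapping.lookup f m * Poly_Mapping.lookup g m * of_nat (sqnorm m))"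
  unfolding form_def using assms by (intro sum.mono_neutral_left) (auto simp: in_keys_iff)

lemma form_commute: "form f g = form g f"
proof -
  let ?S = "Poly_Mapping.keys f \<union> Poly_Mapping.keys g"
  show ?thesis
    by (subst (1 2) form_supset[where S = ?S]) (auto simp: mult.commute)
qed

lemma form_add_left: "form (f + f') g = form f g + form f' g"
proof -
  let ?S = "Poly_Mapping.keys f \<union> Poly_Mapping.keys f'"
  show ?thesis
    by (subst (1 2 3) form_supset[where S = ?S])
      (use keys_add[of f f'] in \<open>auto simp: lookup_add algebra_simps sum.distrib\<close>)
qed

lemma form_add_right: "form g (f + f') = form g f + form g f'"
  by (simp add: form_commute[of g] form_add_left)

lemma form_0_left [simp]: "form 0 g = 0"
  by (simp add: form_def)

lemma form_0_right [simp]: "form g 0 = 0"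
  by (simp add: form_def)

lemma form_single_left: "form (Poly_Mapping.single m c) g
  = c * Poly_Mapping.lookup g m * of_nat (sqnorm m)"
  by (subst form_supset[where S = "{m}"]) auto

lemma const_times_single: "const c * Poly_Mapping.single m d = Poly_Mapping.single m (c * d)"
  by (simp add: const_def mult_single)

lemma form_const_left: "form (const c * f) g = c * form f g"
  by (induction f rule: poly_mapping_induct_single)
    (simp_all add: const_times_single form_single_left form_add_left algebra_simps)

lemma form_const_right: "form g (const c * f) = c * form g f"
  by (simp add: form_commute[of g] form_const_left)

lemma form_sum_left: "form (sum f A) g = (\<Sum>x\<in>A. form (f x) g)"
  by (induction A rule: infinite_finite_induct) (simp_all add: form_add_left)

lemma form_sum_right: "form g (sum f A) = (\<Sum>x\<in>A. form g (f x))"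
  by (simp add: form_commute[of g] form_sum_left)

lemma form_of_nat_left: "form (of_nat n * f) g = of_nat n * form f g"
  by (simp flip: const_of_nat add: form_const_left)

lemma form_of_nat_right: "form g (of_nat n * f) = of_nat n * form g f"
  by (simp flip: const_of_nat add: form_const_right)

text \<open>The scaling of \<open>\<partial>/\<partial>a\<^bsub>-jr\<^esub>\<close> by \<open>r\<close> makes it the adjoint of multiplication by the variable.\<close>

definition deriv_var :: "nat \<times> nat \<Rightarrow> V \<Rightarrow> V" where
  "deriv_var v f = (\<Sum>m\<in>Poly_Mapping.keys f. Poly_Mapping.single (m - Poly_Mapping.single v 1)
     (of_nat (snd v * Poly_Mapping.lookup m v) * Poly_Mapping.lookup f m))"

lemma deriv_var_supset:
  assumes "finite S" and "Poly_Mapping.keys f \<subseteq> S"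
  shows "deriv_var v f = (\<Sum>m\<in>S. Poly_Mapping.single (m - Poly_Mapping.single v 1)
     (of_nat (snd v * Poly_Mapping.lookup m v) * Poly_Mapping.lookup f m))"
  unfolding deriv_var_def using assms
  by (intro sum.mono_neutral_left) (auto simp: in_keys_iff)

lemma deriv_var_add: "deriv_var v (f + g) = deriv_var v f + deriv_var v g"
proof -
  let ?S = "Poly_Mapping.keys f \<union> Poly_Mapping.keys g"
  show ?thesis
    by (subst (1 2 3) deriv_var_supset[where S = ?S])
      (use keys_add[of f g] in \<open>auto simp: lookup_add distrib_left single_add sum.distrib\<close>)
qed

lemma deriv_var_0 [simp]: "deriv_var v 0 = 0"
  by (simp add: deriv_var_def)

lemma deriv_var_single: "deriv_var v (Poly_Mapping.single m c)
  = Poly_Mapping.single (m - Poly_Mapping.single v 1) (of_nat (snd v * Poly_Mapping.lookup m v) * c)"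
  by (subst deriv_var_supset[where S = "{m}"]) auto

lemma deriv_var_sum: "deriv_var v (sum f A) = (\<Sum>x\<in>A. deriv_var v (f x))"
  by (induction A rule: infinite_finite_induct) (simp_all add: deriv_var_add)

text \<open>Subtraction of exponents is truncated, so the two sides can differ at exponent 0; there
  the coefficient in \<open>deriv_var\<close> is 0.\<close>

lemma minus_single_add:
  fixes m m' :: monom
  assumes "Poly_Mapping.lookup m v > 0"
  shows "m - Poly_Mapping.single v 1 + m' = m + m' - Poly_Mapping.single v 1"
  using assms by (intro poly_mapping_eqI)
    (auto simp: lookup_add lookup_minus lookup_single when_def)

lemma deriv_var_mult: "deriv_var v (f * g) = deriv_var v f * g + f * deriv_var v g"
proof (induction f rule: poly_mapping_induct_single)
  case (single m c)
  show ?case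
  proof (induction g rule: poly_mapping_induct_single)
    case (single m' c')
    have 1: "deriv_var v (Poly_Mapping.single m c) * Poly_Mapping.single m' c'
      = Poly_Mapping.single (m + m' - Poly_Mapping.single v 1)
          (of_nat (snd v * Poly_Mapping.lookup m v) * (c * c'))"
      by (cases "Poly_Mapping.lookup m v = 0")
        (simp_all add: deriv_var_single mult_single minus_single_add mult.assoc
          del: One_nat_def)
    have 2: "Poly_Mapping.single m c * deriv_var v (Poly_Mapping.single m' c')
      = Poly_Mapping.single (m + m' - Poly_Mapping.single v 1)
          (of_nat (snd v * Poly_Mapping.lookup m' v) * (c * c'))"
      using minus_single_add[of m' v m] by (cases "Poly_Mapping.lookup m' v = 0")
        (simp_all add: deriv_var_single mult_single add.commute algebra_simps
          del: One_nat_def)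
    show ?case
      unfolding 1 2 unfolding mult_single deriv_var_single lookup_add
      by (simp flip: single_add add: algebra_simps)
  qed (simp_all add: deriv_var_add algebra_simps)
qed (simp_all add: deriv_var_add algebra_simps)

lemma deriv_var_const [simp]: "deriv_var v (const c) = 0"
  by (simp add: const_def deriv_var_single)

lemma deriv_var_const_mult: "deriv_var v (const c * f) = const c * deriv_var v f"
  by (simp add: deriv_var_mult)

lemma deriv_var_of_nat_mult: "deriv_var v (of_nat n * f) = of_nat n * deriv_var v f"
  by (simp flip: const_of_nat add: deriv_var_const_mult)

lemma deriv_var_avar: "deriv_var v (avar j r) = (if v = (j, r) then of_nat r else 0)"
  unfolding const_of_nat[symmetric] const_def avar_def deriv_var_single
  by (auto simp: lookup_single when_def)

lemma sqnorm_supset: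
  assumes "finite S" and "Poly_Mapping.keys m \<subseteq> S"
  shows "sqnorm m = (\<Prod>v\<in>S. snd v ^ Poly_Mapping.lookup m v * fact (Poly_Mapping.lookup m v))"
  unfolding sqnorm_def using assms
  by (intro prod.mono_neutral_left) (auto simp: in_keys_iff)

text \<open>The ratio of the squared norms is exactly the coefficient that
  \<open>deriv_var v\<close> produces on the larger monomial; this is the source of
  adjointness.\<close>

lemma sqnorm_add_single:
  "sqnorm (Poly_Mapping.single v 1 + m) = snd v * Suc (Poly_Mapping.lookup m v) * sqnorm m"
proof -
  let ?S = "insert v (Poly_Mapping.keys m)"
  have "sqnorm (Poly_Mapping.single v 1 + m) =
      snd v ^ Suc (Poly_Mapping.lookup m v) * fact (Suc (Poly_Mapping.lookup m v)) *
      (\<Prod>w\<in>?S - {v}. snd w ^ Poly_Mapping.lookup m w * fact (Poly_Mapping.lookup m w))"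
    using keys_add[of "Poly_Mapping.single v 1" m]
    by (subst sqnorm_supset[where S = ?S], force, force, subst prod.remove[of _ v])
      (auto simp: lookup_add lookup_single intro!: prod.cong)
  moreover have "sqnorm m =
      snd v ^ Poly_Mapping.lookup m v * fact (Poly_Mapping.lookup m v) *
      (\<Prod>w\<in>?S - {v}. snd w ^ Poly_Mapping.lookup m w * fact (Poly_Mapping.lookup m w))"
    by (subst sqnorm_supset[where S = ?S], force, force, subst prod.remove[of _ v]) auto
  ultimately show ?thesis by (simp only: power_Suc fact_Suc of_nat_id mult_ac)
qed

lemma form_avar_mult: "form (avar j r * f) g = form f (deriv_var (j, r) g)"
proof (induction f rule: poly_mapping_induct_single)
  case (single m c)
  let ?d = "Poly_Mapping.single (j, r) (1::nat)"
  show ?case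
  proof (induction g rule: poly_mapping_induct_single)
    case (single m' c')
    have 1: "Poly_Mapping.lookup (Poly_Mapping.single m' c') (?d + m) = (c' when m' = ?d + m)"
      by (simp add: lookup_single)
    have 2: "m = m' - ?d" if "m' = ?d + m" using that by simp
    \<comment> \<open>Truncated subtraction can also send another \<open>m'\<close> to
      \<open>m\<close>, but only when the exponent of \<open>(j, r)\<close> in \<open>m'\<close> is
      0, and then the coefficient in 5 vanishes.\<close>
    have 3: "m' = ?d + m" if "m = m' - ?d" "Poly_Mapping.lookup m' (j, r) > 0"
      using minus_single_add[of m' "(j, r)" ?d] that by (simp add: add.commute)
    have 4: "form (avar j r * Poly_Mapping.single m c) (Poly_Mapping.single m' c')
      = c * (c' when m' = ?d + m) * of_nat (r * Suc (Poly_Mapping.lookup m (j, r)) * sqnorm m)"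
      unfolding avar_def mult_single form_single_left sqnorm_add_single 1 by simp
    have 5: "form (Poly_Mapping.single m c) (deriv_var (j, r) (Poly_Mapping.single m' c'))
      = c * (of_nat (r * Poly_Mapping.lookup m' (j, r)) * c' when m = m' - ?d) * of_nat (sqnorm m)"
      unfolding deriv_var_single form_single_left by (simp add: lookup_single when_def)
    show ?case
    proof (cases "m' = ?d + m")
      case True
      then show ?thesis
        unfolding 4 5 by (simp add: lookup_add)
    next
      case False
      then have "m \<noteq> m' - ?d \<or> Poly_Mapping.lookup m' (j, r) = 0"
        using 3 by blast
      with False show ?thesis
        unfolding 4 5 by (auto simp: when_def)
    qed
  qed (simp_all add: form_add_right deriv_var_add)
qed (simp_all add: form_add_left algebra_simps)

subsection \<open>Skewing operators\<close>

lemma is_partition_eqI: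
  assumes "is_partition \<mu>" "is_partition \<nu>" "mset \<mu> = mset \<nu>"
  shows "\<mu> = \<nu>"
proof -
  have "sorted (rev \<mu>)" "sorted (rev \<nu>)"
    using assms(1,2) by (simp_all add: is_partition_def sorted_wrt_rev)
  then have "rev \<mu> = rev \<nu>"
    by (metis assms(3) mset_rev properties_for_sort)
  then show ?thesis by simp
qed

lemma is_partition_rev_sort: "0 \<notin> set xs \<Longrightarrow> is_partition (rev (sort xs))"
  by (simp add: is_partition_def sorted_wrt_rev)

lemma is_partition_remove1: "is_partition \<mu> \<Longrightarrow> is_partition (remove1 r \<mu>)"
  unfolding is_partition_def
  by (induction \<mu>) (auto dest: set_remove1_subset[THEN subsetD])

lemma finite_partitions [simp]: "finite (partitions n)"
proof -
  have "length \<mu> \<le> sum_list \<mu>" if "0 \<notin> set \<mu>" for \<mu> :: "nat list"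
    using that by (induction \<mu>) auto
  then have "partitions n \<subseteq> {\<mu>. set \<mu> \<subseteq> {..n} \<and> length \<mu> \<le> n}"
    by (auto simp: partitions_def is_partition_def member_le_sum_list)
  then show ?thesis by (rule finite_subset) (simp add: finite_lists_length_le)
qed

lemma partitions_0: "partitions 0 = {[]}"
  by (auto simp: partitions_def is_partition_def sum_list_eq_0_iff) (metis list.set_sel(1))

lemma z_part_mset_cong:
  assumes "mset \<mu> = mset \<nu>"
  shows "z_part \<mu> = z_part \<nu>"
proof -
  have "count_list \<mu> i = count_list \<nu> i" for i
    using assms by (simp flip: count_mset)
  then show ?thesis
    unfolding z_part_def by (simp add: mset_eq_setD[OF assms])
qed

text \<open>Stated for arbitrary lists, since \<open>z_part\<close> sees only multiplicities. The
  extra factor cancels the count in \<open>psum_exp_rec\<close>.\<close>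

lemma z_part_Cons: "z_part (r # \<nu>) = r * Suc (count_list \<nu> r) * z_part \<nu>"
proof -
  let ?P = "\<lambda>\<mu>. \<Prod>i\<in>set \<nu> - {r}. i ^ count_list \<mu> i * fact (count_list \<mu> i)"
  have "z_part (r # \<nu>) = r ^ Suc (count_list \<nu> r) * fact (Suc (count_list \<nu> r)) * ?P (r # \<nu>)"
    unfolding z_part_def by (simp add: prod.insert_remove)
  moreover have "?P (r # \<nu>) = ?P \<nu>"
    by (intro prod.cong) auto
  moreover have "z_part \<nu> = r ^ count_list \<nu> r * fact (count_list \<nu> r) * ?P \<nu>"
  proof (cases "r \<in> set \<nu>")
    case True
    then show ?thesis unfolding z_part_def by (subst prod.remove[of _ r]) auto
  next
    case False
    then show ?thesis unfolding z_part_def by (simp add: count_list_0_iff)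
  qed
  ultimately show ?thesis by (simp only: power_Suc fact_Suc of_nat_id mult_ac)
qed

text \<open>The coefficient of \<open>u\<^sup>n\<close> in \<open>exp (\<epsilon> \<Sum>\<^sub>r p\<^sub>r u\<^sup>r / r)\<close>. It is the complete homogeneous
  function for \<open>\<epsilon> = 1\<close> and \<open>(-1)\<^sup>n\<close> times the elementary one for \<open>\<epsilon> = -1\<close>.\<close>

definition psum_exp :: "complex \<Rightarrow> (nat \<Rightarrow> V) \<Rightarrow> nat \<Rightarrow> V" where
  "psum_exp \<epsilon> p n =
    (\<Sum>\<mu>\<in>partitions n. const (\<epsilon> ^ length \<mu> / of_nat (z_part \<mu>)) * prod_list (map p \<mu>))"

lemma psum_exp_0 [simp]: "psum_exp \<epsilon> p 0 = 1"
  by (simp add: psum_exp_def partitions_0 z_part_def)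

lemma hom_sym_int: "hom_sym p (int n) = psum_exp 1 p n"
  by (simp add: hom_sym_def psum_exp_def)

text \<open>Logarithmic derivative of the exponential series, proved combinatorially:
  \<open>n\<close> is the sum of \<open>r\<close> times its multiplicity over the distinct parts
  \<open>r\<close> of a partition, and pairs of a partition of \<open>n\<close> and a distinct part
  \<open>r\<close> correspond to pairs of \<open>r\<close> and a partition of
  \<open>n - r\<close>.\<close>

lemma psum_exp_rec:
  "of_nat n * psum_exp \<epsilon> p n = const \<epsilon> * (\<Sum>r=1..n. p r * psum_exp \<epsilon> p (n - r))"
proof -
  let ?t = "\<lambda>\<mu>. const (\<epsilon> ^ length \<mu> / of_nat (z_part \<mu>)) * prod_list (map p \<mu>)"
  define ins where "ins r \<nu> = rev (sort (r # \<nu>))" for r :: nat and \<nu>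
  have part: "is_partition \<mu>" "sum_list \<mu> = m" if "\<mu> \<in> partitions m" for \<mu> m
    using that by (simp_all add: partitions_def)
  have term_cong: "?t \<mu> = ?t \<nu>" if "mset \<mu> = mset \<nu>" for \<mu> \<nu>
  proof -
    have "length \<mu> = length \<nu>" using that by (metis size_mset)
    moreover have "prod_list (map p \<mu>) = prod_list (map p \<nu>)"
      by (metis that mset_map prod_mset_prod_list)
    ultimately show ?thesis using z_part_mset_cong[OF that] by simp
  qed
  \<comment> \<open>The multiplicity times \<open>r\<close> cancels against the ratio of the two
    values of \<open>z_part\<close>, leaving one factor \<open>\<epsilon>\<close> and one factor
    \<open>p r\<close>.\<close>
  have step: "of_nat (count_list \<mu> r * r) * ?t \<mu> = const \<epsilon> * (p r * ?t (remove1 r \<mu>))"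
    if \<mu>: "\<mu> \<in> partitions n" "r \<in> set \<mu>" for \<mu> r
  proof -
    let ?\<nu> = "remove1 r \<mu>"
    have r: "r > 0" using \<mu> by (auto simp: partitions_def is_partition_def intro: Suc_leI gr0I)
    have ms: "mset \<mu> = mset (r # ?\<nu>)" using \<mu> by simp
    then have "count_list \<mu> r = Suc (count_list ?\<nu> r)"
      by (metis count_list.simps(2) count_mset add.commute plus_1_eq_Suc)
    then have "of_nat (count_list \<mu> r * r) * ?t \<mu>
      = of_nat (r * Suc (count_list ?\<nu> r)) * ?t (r # ?\<nu>)"
      using term_cong[OF ms] by (simp add: mult.commute)
    also have "\<dots> = const (of_nat (r * Suc (count_list ?\<nu> r)) *
        (\<epsilon> ^ Suc (length ?\<nu>) / of_nat (z_part (r # ?\<nu>)))) * (p r * prod_list (map p ?\<nu>))"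
      by (simp only: const_of_nat[symmetric] const_mult list.map prod_list.Cons mult.assoc
          list.size add_Suc_right add_0_right)
    also have "of_nat (r * Suc (count_list ?\<nu> r)) * (\<epsilon> ^ Suc (length ?\<nu>) / of_nat (z_part (r # ?\<nu>)))
      = \<epsilon> * (\<epsilon> ^ length ?\<nu> / of_nat (z_part ?\<nu>))"
    proof -
      define x :: complex where "x = of_nat (r * Suc (count_list ?\<nu> r))"
      have "x \<noteq> 0" using r unfolding x_def of_nat_eq_0_iff by simp
      then show ?thesis
        unfolding z_part_Cons of_nat_mult[of "r * _"] x_def[symmetric] by simp
    qed
    finally show ?thesis by (simp only: const_mult mult_ac)
  qed
  have remove: "ins r (remove1 r \<mu>) = \<mu>" "r \<le> n" "Suc 0 \<le> r" "remove1 r \<mu> \<in> partitions (n - r)"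
    if \<mu>: "\<mu> \<in> partitions n" "r \<in> set \<mu>" for \<mu> r
  proof -
    have 0: "0 \<notin> set \<mu>" using \<mu> by (auto simp: partitions_def is_partition_def)
    then show r: "Suc 0 \<le> r" using \<mu>(2) by (metis Suc_leI gr0I)
    have ms: "mset (remove1 r \<mu>) + {#r#} = mset \<mu>" using \<mu> by simp
    show "ins r (remove1 r \<mu>) = \<mu>"
      unfolding ins_def using \<mu> 0 r by (intro is_partition_eqI is_partition_rev_sort)
        (auto dest: set_remove1_subset[THEN subsetD] simp: partitions_def)
    have "sum_list (remove1 r \<mu>) + r = n"
      using \<mu> ms by (metis (no_types, lifting) part(2) sum_mset_sum_list sum_mset.union sum_mset.singleton)
    then show "r \<le> n" "remove1 r \<mu> \<in> partitions (n - r)"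
      using part(1)[OF \<mu>(1)] by (auto simp: partitions_def is_partition_remove1)
  qed
  have insert: "remove1 r (ins r \<nu>) = \<nu>" "ins r \<nu> \<in> partitions n" "r \<in> set (ins r \<nu>)"
    if r: "r \<le> n" "Suc 0 \<le> r" and \<nu>: "\<nu> \<in> partitions (n - r)" for r \<nu>
  proof -
    have "0 \<notin> set (r # \<nu>)" using \<nu> r by (auto simp: partitions_def is_partition_def)
    then have ins: "is_partition (ins r \<nu>)"
      unfolding ins_def by (rule is_partition_rev_sort)
    then show "remove1 r (ins r \<nu>) = \<nu>"
      by (intro is_partition_eqI is_partition_remove1 part(1)[OF \<nu>]) (simp_all add: ins_def)
    have "sum_list (ins r \<nu>) = sum_list (r # \<nu>)"
      unfolding ins_def by (metis mset_rev mset_sort sum_mset_sum_list)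
    then show "ins r \<nu> \<in> partitions n"
      using ins r part(2)[OF \<nu>] by (simp add: partitions_def)
    show "r \<in> set (ins r \<nu>)" by (simp add: ins_def set_insort_key)
  qed
  have "of_nat n * psum_exp \<epsilon> p n = (\<Sum>\<mu>\<in>partitions n. of_nat n * ?t \<mu>)"
    by (simp add: psum_exp_def sum_distrib_left)
  also have "\<dots> = (\<Sum>\<mu>\<in>partitions n. \<Sum>r\<in>set \<mu>. of_nat (count_list \<mu> r * r) * ?t \<mu>)"
  proof (intro sum.cong refl)
    fix \<mu> assume "\<mu> \<in> partitions n"
    then have "n = (\<Sum>r\<in>set \<mu>. count_list \<mu> r * r)"
      using sum_list_map_eq_sum_count[of "\<lambda>x. x" \<mu>] by (simp add: partitions_def)
    then have "(of_nat n :: V) = of_nat (\<Sum>r\<in>set \<mu>. count_list \<mu> r * r)"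
      by (rule arg_cong)
    then show "of_nat n * ?t \<mu> = (\<Sum>r\<in>set \<mu>. of_nat (count_list \<mu> r * r) * ?t \<mu>)"
      by (simp only: of_nat_sum sum_distrib_right)
  qed
  also have "\<dots> = (\<Sum>(\<mu>, r)\<in>Sigma (partitions n) set. of_nat (count_list \<mu> r * r) * ?t \<mu>)"
    by (simp add: sum.Sigma)
  also have "\<dots> = (\<Sum>(r, \<nu>)\<in>Sigma {1..n} (\<lambda>r. partitions (n - r)). const \<epsilon> * (p r * ?t \<nu>))"
    by (rule sum.reindex_bij_witness[where j = "\<lambda>(\<mu>, r). (r, remove1 r \<mu>)"
          and i = "\<lambda>(r, \<nu>). (ins r \<nu>, r)"])
      (auto simp: remove insert step simp del: of_nat_mult)
  also have "\<dots> = (\<Sum>r=1..n. \<Sum>\<nu>\<in>partitions (n - r). const \<epsilon> * (p r * ?t \<nu>))"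
    by (simp add: sum.Sigma)
  finally show ?thesis by (simp add: psum_exp_def sum_distrib_left)
qed

text \<open>\<open>skew j \<epsilon> n\<close> is the adjoint of multiplication by \<open>psum_exp \<epsilon> (avar j) n\<close>; the recursion
  is the adjoint of \<open>psum_exp_rec\<close>.\<close>

fun skew :: "nat \<Rightarrow> complex \<Rightarrow> nat \<Rightarrow> V \<Rightarrow> V" where
  "skew j \<epsilon> 0 g = g"
| "skew j \<epsilon> (Suc n) g =
    const (\<epsilon> / of_nat (Suc n)) * (\<Sum>r\<le>n. deriv_var (j, Suc r) (skew j \<epsilon> (n - r) g))"

text \<open>The recursion reindexed and freed of division; it also covers \<open>n = 0\<close>,
  where both sides vanish.\<close>

lemma of_nat_skew:
  "of_nat n * skew j \<epsilon> n g = const \<epsilon> * (\<Sum>r=1..n. deriv_var (j, r) (skew j \<epsilon> (n - r) g))"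
proof (cases n)
  case (Suc m)
  have "(\<Sum>r=1..n. deriv_var (j, r) (skew j \<epsilon> (n - r) g))
    = (\<Sum>r\<le>m. deriv_var (j, Suc r) (skew j \<epsilon> (m - r) g))"
    unfolding Suc by (intro sum.reindex_bij_witness[where j = "\<lambda>r. r - 1" and i = Suc]) auto
  then show ?thesis
    unfolding Suc skew.simps mult.assoc[symmetric]
    by (simp add: const_inverse_of_nat mult.commute[of "of_nat _"] del: of_nat_Suc)
qed simp

lemma form_psum_exp_mult: "form (psum_exp \<epsilon> (avar j) n * f) g = form f (skew j \<epsilon> n g)"
\<comment> \<open>\<open>f\<close> stays arbitrary because the recursion absorbs the factor
  \<open>avar j r\<close> into it.\<close>
proof (induction n arbitrary: f rule: less_induct)
  case (less n)
  show ?case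
  proof (cases "n = 0")
    case False
    have "of_nat n * form (psum_exp \<epsilon> (avar j) n * f) g
      = form ((of_nat n * psum_exp \<epsilon> (avar j) n) * f) g"
      by (simp add: mult.assoc form_of_nat_left)
    also have "\<dots> = \<epsilon> * (\<Sum>r=1..n. form (psum_exp \<epsilon> (avar j) (n - r) * (avar j r * f)) g)"
      unfolding psum_exp_rec mult.assoc sum_distrib_right form_const_left form_sum_left
      by (simp add: mult.left_commute)
    also have "\<dots> = \<epsilon> * (\<Sum>r=1..n. form f (deriv_var (j, r) (skew j \<epsilon> (n - r) g)))"
      using False by (intro arg_cong[where f = "(*) \<epsilon>"] sum.cong refl)
        (simp add: less.IH form_avar_mult)
    also have "\<dots> = of_nat n * form f (skew j \<epsilon> n g)"
      by (simp flip: form_of_nat_right add: of_nat_skew form_const_right form_sum_right)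
    finally show ?thesis using False by simp
  qed simp
qed

lemma skew_add: "skew j \<epsilon> n (f + g) = skew j \<epsilon> n f + skew j \<epsilon> n g"
  by (induction j \<epsilon> n g rule: skew.induct)
    (simp_all add: deriv_var_add sum.distrib distrib_left)

lemma skew_eq_0:
  assumes "\<And>r. deriv_var (j, Suc r) g = 0" and "n > 0"
  shows "skew j \<epsilon> n g = 0"
  using assms(2)
proof (induction n rule: less_induct)
  case (less n)
  have "deriv_var (j, r) (skew j \<epsilon> (n - r) g) = 0" if "r \<in> {1..n}" for r
    using that less assms(1)[of "r - 1"] by (cases "n = r") auto
  then have "of_nat n * skew j \<epsilon> n g = of_nat n * 0"
    by (simp add: of_nat_skew)
  then show ?case using less.prems of_nat_V_cancel by blast
qed

text \<open>Skewing of lower positive order yields constants, whose derivatives vanish; only the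
  summand \<open>s = n\<close> of the recursion remains.\<close>

lemma skew_avar:
  assumes "n > 0" and "r > 0"
  shows "skew j \<epsilon> n (avar j r) = (if n = r then const \<epsilon> else 0)"
  using assms(1)
proof (induction n rule: less_induct)
  case (less n)
  have "deriv_var (j, s) (skew j \<epsilon> (n - s) (avar j r)) = (if s = n \<and> n = r then of_nat n else 0)"
    if "s \<in> {1..n}" for s
    using that less.IH[of "n - s"] by (cases "n = s") (auto simp: deriv_var_avar)
  then have "(\<Sum>s=1..n. deriv_var (j, s) (skew j \<epsilon> (n - s) (avar j r)))
    = (\<Sum>s=1..n. if s = n then if n = r then of_nat n else 0 else 0)"
    by (intro sum.cong) auto
  then have "of_nat n * skew j \<epsilon> n (avar j r) = of_nat n * (if n = r then const \<epsilon> else 0)"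
    using less.prems unfolding of_nat_skew by (simp add: mult.commute)
  then show ?case using less.prems of_nat_V_cancel by blast
qed

text \<open>The series of these operators is the exponential of a derivation, hence multiplicative.
  In coefficients: the convolution obeys the recursion of \<open>of_nat_skew\<close>, on writing
  \<open>n\<close> as \<open>i + (n - i)\<close> and using the Leibniz rule.\<close>

lemma skew_mult: "skew j \<epsilon> n (f * g) = (\<Sum>i\<le>n. skew j \<epsilon> i f * skew j \<epsilon> (n - i) g)"
proof (induction n rule: less_induct)
  case (less n)
  let ?S = "skew j \<epsilon>" and ?D = "\<lambda>r. deriv_var (j, r)"
  \<comment> \<open>This handles the weight \<open>i\<close>; the weight \<open>n - i\<close>
    follows on exchanging \<open>f\<close> and \<open>g\<close>.\<close>
  have half: "(\<Sum>i\<le>n. of_nat i * ?S i f * ?S (n - i) g)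
      = const \<epsilon> * (\<Sum>r=1..n. \<Sum>i\<le>n - r. ?D r (?S i f) * ?S (n - r - i) g)" for f g
  proof -
    have "(\<Sum>i\<le>n. of_nat i * ?S i f * ?S (n - i) g)
      = const \<epsilon> * (\<Sum>i\<le>n. \<Sum>r=1..i. ?D r (?S (i - r) f) * ?S (n - i) g)"
      by (simp only: of_nat_skew sum_distrib_left sum_distrib_right mult.assoc)
    also have "(\<Sum>i\<le>n. \<Sum>r=1..i. ?D r (?S (i - r) f) * ?S (n - i) g)
      = (\<Sum>r=1..n. \<Sum>i\<le>n - r. ?D r (?S i f) * ?S (n - r - i) g)"
      unfolding sum.Sigma[OF finite_atMost ballI[OF finite_atLeastAtMost]]
        sum.Sigma[OF finite_atLeastAtMost ballI[OF finite_atMost]]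
      by (intro sum.reindex_bij_witness[where i = "\<lambda>(r, i). (i + r, r)"
            and j = "\<lambda>(i, r). (r, i - r)"]) auto
    finally show ?thesis .
  qed
  have flip: "(\<Sum>i\<le>m. ?D r (?S i g) * ?S (m - i) f) = (\<Sum>i\<le>m. ?S i f * ?D r (?S (m - i) g))"
    for m r
    by (intro sum.reindex_bij_witness[where i = "\<lambda>i. m - i" and j = "\<lambda>i. m - i"])
      (auto simp: mult.commute)
  show ?case
  proof (cases "n = 0")
    case False
    have "of_nat n * (\<Sum>i\<le>n. ?S i f * ?S (n - i) g)
      = (\<Sum>i\<le>n. of_nat i * ?S i f * ?S (n - i) g + of_nat (n - i) * ?S (n - i) g * ?S i f)"
      unfolding sum_distrib_left
      by (intro sum.cong refl) (auto simp: algebra_simps simp flip: distrib_right of_nat_add)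
    also have "\<dots> = (\<Sum>i\<le>n. of_nat i * ?S i f * ?S (n - i) g)
        + (\<Sum>i\<le>n. of_nat i * ?S i g * ?S (n - i) f)"
      unfolding sum.distrib
      by (intro arg_cong2[where f = "(+)"] refl
          sum.reindex_bij_witness[where i = "\<lambda>i. n - i" and j = "\<lambda>i. n - i"]) auto
    also have "(\<Sum>i\<le>n. of_nat i * ?S i g * ?S (n - i) f)
      = const \<epsilon> * (\<Sum>r=1..n. \<Sum>i\<le>n - r. ?S i f * ?D r (?S (n - r - i) g))"
      by (simp only: half flip)
    also have "(\<Sum>i\<le>n. of_nat i * ?S i f * ?S (n - i) g)
        + const \<epsilon> * (\<Sum>r=1..n. \<Sum>i\<le>n - r. ?S i f * ?D r (?S (n - r - i) g))
      = const \<epsilon> * (\<Sum>r=1..n. ?D r (\<Sum>i\<le>n - r. ?S i f * ?S (n - r - i) g))"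
      unfolding half by (simp add: deriv_var_sum deriv_var_mult sum.distrib distrib_left)
    also have "\<dots> = of_nat n * ?S n (f * g)"
      unfolding of_nat_skew using less False by simp
    finally show ?thesis using False of_nat_V_cancel by force
  qed simp
qed

subsection \<open>The Bernstein recursion for Schur functions\<close>

definition skew_fps :: "nat \<Rightarrow> complex \<Rightarrow> V \<Rightarrow> V fps" where
  "skew_fps j \<epsilon> g = Abs_fps (\<lambda>n. skew j \<epsilon> n g)"

lemma fps_nth_skew_fps [simp]: "fps_nth (skew_fps j \<epsilon> g) n = skew j \<epsilon> n g"
  by (simp add: skew_fps_def)

lemma skew_fps_eq_fps_const:
  assumes "\<And>r. deriv_var (j, Suc r) g = 0"
  shows "skew_fps j \<epsilon> g = fps_const g"
  by (intro fps_ext) (auto simp: skew_eq_0[OF assms])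

lemma skew_fps_const [simp]: "skew_fps j \<epsilon> (const c) = fps_const (const c)"
  by (rule skew_fps_eq_fps_const) simp

text \<open>A ring homomorphism commutes with determinants and finite products, so Schur functions
  can be treated entry by entry and \<open>a_tilde_colored\<close> factor by factor.\<close>

interpretation skew_fps: comm_ring_hom "skew_fps j \<epsilon>" for j \<epsilon>
proof
  show "skew_fps j \<epsilon> 0 = 0" "skew_fps j \<epsilon> 1 = 1"
    using skew_fps_const[of j \<epsilon> 0] skew_fps_const[of j \<epsilon> 1] by simp_all
  show "skew_fps j \<epsilon> (f + g) = skew_fps j \<epsilon> f + skew_fps j \<epsilon> g" for f g
    by (rule fps_ext) (simp add: skew_add)
  show "skew_fps j \<epsilon> (f * g) = skew_fps j \<epsilon> f * skew_fps j \<epsilon> g" for f g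
    by (rule fps_ext) (simp add: skew_mult fps_mult_nth atLeast0AtMost)
qed

lemma skew_fps_avar:
  assumes "r > 0"
  shows "skew_fps j \<epsilon> (avar i r)
    = fps_const (avar i r) + (if i = j then fps_const (const \<epsilon>) * fps_X ^ r else 0)"
proof (cases "i = j")
  case True
  then show ?thesis
    using assms skew_avar[of _ r j \<epsilon>]
    by (intro fps_ext) (auto simp: fps_X_power_nth gr0_conv_Suc)
next
  case False
  then show ?thesis by (simp add: skew_fps_eq_fps_const deriv_var_avar)
qed

text \<open>Differentiating the exponential series multiplies it by \<open>\<epsilon> u^r\<close>.
  In the induction, the product rule applied to \<open>psum_exp_rec\<close> gives \<open>r\<close>
  copies of \<open>?G (n - r)\<close> from the derivative of \<open>avar j r\<close> and
  \<open>n - r\<close> copies from the other terms, \<open>n\<close> in total.\<close>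

lemma deriv_var_psum_exp:
  assumes "r > 0"
  shows "deriv_var (j, r) (psum_exp \<epsilon> (avar j) n)
    = (if r \<le> n then const \<epsilon> * psum_exp \<epsilon> (avar j) (n - r) else 0)"
proof (induction n rule: less_induct)
  case (less n)
  let ?G = "psum_exp \<epsilon> (avar j)" and ?D = "deriv_var (j, r)"
  show ?case
  proof (cases "n = 0")
    case True
    then show ?thesis using assms deriv_var_const[of _ 1] by simp
  next
    case False
    have "of_nat n * ?D (?G n) = const \<epsilon> * (\<Sum>s=1..n. ?D (avar j s) * ?G (n - s))
        + const \<epsilon> * (\<Sum>s=1..n. avar j s * ?D (?G (n - s)))"
      by (simp flip: deriv_var_of_nat_mult
          add: psum_exp_rec deriv_var_const_mult deriv_var_sum deriv_var_mult sum.distrib distrib_left)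
    also have "(\<Sum>s=1..n. ?D (avar j s) * ?G (n - s)) = (\<Sum>s=1..n. if s = r then of_nat r * ?G (n - r) else 0)"
      by (intro sum.cong) (auto simp: deriv_var_avar)
    also have "\<dots> = (if r \<le> n then of_nat r * ?G (n - r) else 0)"
      using assms by simp
    also have "(\<Sum>s=1..n. avar j s * ?D (?G (n - s)))
      = (\<Sum>s=1..n. if s \<le> n - r \<and> r \<le> n then const \<epsilon> * (avar j s * ?G (n - r - s)) else 0)"
      using assms by (intro sum.cong) (auto simp: less.IH mult_ac add.commute diff_diff_left)
    also have "\<dots> = (if r \<le> n then const \<epsilon> * (\<Sum>s=1..n-r. avar j s * ?G (n - r - s)) else 0)"
      by (auto simp: sum_distrib_left intro!: sum.mono_neutral_cong_right)
    also have "\<dots> = (if r \<le> n then of_nat (n - r) * ?G (n - r) else 0)"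
      by (simp only: psum_exp_rec)
    finally have "of_nat n * ?D (?G n) = of_nat n * (if r \<le> n then const \<epsilon> * ?G (n - r) else 0)"
      by (auto simp: of_nat_diff algebra_simps)
    then show ?thesis using False of_nat_V_cancel by blast
  qed
qed

lemma hom_sym_neg [simp]: "k < 0 \<Longrightarrow> hom_sym p k = 0"
  by (simp add: hom_sym_def)

lemma deriv_var_hom_sym:
  assumes "r > 0"
  shows "deriv_var (j, r) (hom_sym (avar j) k) = hom_sym (avar j) (k - int r)"
proof (cases "k < 0")
  case False
  then obtain n where k: "k = int n" by (metis linorder_not_less nonneg_int_cases)
  show ?thesis
  proof (cases "r \<le> n")
    case True
    then have "k - int r = int (n - r)" by (simp add: k)
    then show ?thesis using True assms by (simp only: k hom_sym_int deriv_var_psum_exp) simp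
  qed (simp_all add: k hom_sym_int deriv_var_psum_exp assms)
qed simp

text \<open>The derivation for \<open>r\<close> lowers the index by \<open>r\<close>, like the power
  \<open>S^r\<close> of the shift \<open>S\<close> by one, so the operator series acts as
  \<open>exp (- (\<Sum>r. S^r u^r / r)) = 1 - u S\<close>.\<close>

lemma skew_hom_sym:
  "skew j (-1) n (hom_sym (avar j) k)
    = (if n = 0 then hom_sym (avar j) k else if n = 1 then - hom_sym (avar j) (k - 1) else 0)"
proof (induction n rule: less_induct)
  case (less n)
  let ?h = "hom_sym (avar j)"
  show ?case
  proof (cases "n = 0")
    case False
    \<comment> \<open>Only \<open>r = n\<close> and \<open>r = n - 1\<close> contribute. They
      cancel, except for \<open>n = 1\<close>, where the second lies outside the range.\<close>
    have "(\<Sum>r=1..n. deriv_var (j, r) (skew j (-1) (n - r) (?h k)))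
      = (\<Sum>r=1..n. (if r = n then ?h (k - int n) else 0) - (if Suc r = n then ?h (k - int n) else 0))"
    proof (intro sum.cong refl)
      fix r assume r: "r \<in> {1..n}"
      have "deriv_var (j, r) (- f) = - deriv_var (j, r) f" for f
        using deriv_var_const_mult[of "(j, r)" "-1" f] by (simp add: const_uminus)
      then show "deriv_var (j, r) (skew j (-1) (n - r) (?h k))
        = (if r = n then ?h (k - int n) else 0) - (if Suc r = n then ?h (k - int n) else 0)"
        using r by (auto simp: less.IH deriv_var_hom_sym algebra_simps)
    qed
    also have "\<dots> = (if n = 1 then ?h (k - 1) else 0)"
    proof -
      have "(\<Sum>r=1..n. if Suc r = n then ?h (k - int n) else 0)
        = (\<Sum>r=1..n. if r = n - 1 then ?h (k - int n) else 0)"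
        using False by (intro sum.cong) auto
      then show ?thesis using False by (auto simp: sum_subtractf)
    qed
    finally have "of_nat n * skew j (-1) n (?h k) = of_nat n * (if n = 1 then - ?h (k - 1) else 0)"
      unfolding of_nat_skew by (simp add: const_uminus)
    then show ?thesis using False of_nat_V_cancel[of n "skew j (-1) n (?h k)"] by simp
  qed simp
qed

lemma skew_fps_hom_sym:
  "skew_fps j (-1) (hom_sym (avar j) k)
    = fps_const (hom_sym (avar j) k) - fps_X * fps_const (hom_sym (avar j) (k - 1))"
  by (rule fps_ext) (auto simp: skew_hom_sym)

text \<open>Subtracting \<open>u\<close> times the preceding column from every later one turns the
  first row of \<open>M\<close> into 1, 0, ..., 0 and leaves the matrix on the left as the only
  surviving minor. Expanding \<open>det M\<close> itself along its first row gives the other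
  side.\<close>

lemma det_column_differences:
  fixes x :: "nat \<Rightarrow> nat \<Rightarrow> 'a::comm_ring_1" and u :: 'a and n :: nat
  defines "M \<equiv> mat (Suc n) (Suc n) (\<lambda>(s, t). if s = 0 then u ^ t else x (s - 1) t)"
  shows "det (mat n n (\<lambda>(s, t). x s (Suc t) - u * x s t))
    = (\<Sum>t\<le>n. u ^ t * cofactor M 0 t)"
proof -
  \<comment> \<open>Right multiplication by \<open>U\<close> performs all column operations at once;
    being unitriangular, it preserves the determinant.\<close>
  define U where "U = mat (Suc n) (Suc n)
    (\<lambda>(s, t). if s = t then 1 else if Suc s = t then - u else (0::'a))"
  define B where "B = mat (Suc n) (Suc n)
    (\<lambda>(s, t). if t = 0 then M $$ (s, 0) else M $$ (s, t) - u * M $$ (s, t - 1))"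
  have M: "M \<in> carrier_mat (Suc n) (Suc n)" and U: "U \<in> carrier_mat (Suc n) (Suc n)"
    and B: "B \<in> carrier_mat (Suc n) (Suc n)"
    by (simp_all add: M_def U_def B_def)
  have "M * U = B"
  proof (rule eq_matI)
    fix s t assume "s < dim_row B" "t < dim_col B"
    then have st: "s < Suc n" "t < Suc n" by (simp_all add: B_def)
    have "(M * U) $$ (s, t) = (\<Sum>i<Suc n. M $$ (s, i) * U $$ (i, t))"
      using st M U by (simp add: scalar_prod_def lessThan_atLeast0)
    also have "\<dots> = (\<Sum>i<Suc n. (if i = t then M $$ (s, t) else 0)
        - (if Suc i = t then u * M $$ (s, t - 1) else 0))"
      using st by (intro sum.cong) (auto simp: U_def)
    also have "\<dots> = B $$ (s, t)"
    proof (cases t)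
      case (Suc t')
      then have "t' < Suc n" using st by simp
      then show ?thesis using st by (simp add: B_def Suc sum_subtractf del: sum.lessThan_Suc)
    qed (use st in \<open>simp add: B_def sum_subtractf del: sum.lessThan_Suc\<close>)
    finally show "(M * U) $$ (s, t) = B $$ (s, t)" .
  qed (use M U B in auto)
  moreover have "det U = 1"
  proof -
    have "upper_triangular U" by (auto simp: U_def upper_triangular_def)
    then have "det U = prod_list (diag_mat U)" using U by (rule det_upper_triangular)
    also have "diag_mat U = replicate (Suc n) 1"
      by (intro nth_equalityI) (auto simp: U_def diag_mat_def simp del: upt_Suc replicate_Suc)
    finally show ?thesis by simp
  qed
  ultimately have "det M = det B"
    using det_mult[OF M U] by simp
  also have "\<dots> = (\<Sum>t<Suc n. B $$ (0, t) * cofactor B 0 t)"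
    by (rule laplace_expansion_row[OF B]) simp
  also have "\<dots> = (\<Sum>t<Suc n. if t = 0 then cofactor B 0 0 else 0)"
  proof (intro sum.cong refl)
    fix t assume "t \<in> {..<Suc n}"
    then show "B $$ (0, t) * cofactor B 0 t = (if t = 0 then cofactor B 0 0 else 0)"
      by (cases t) (auto simp: B_def M_def)
  qed
  also have "\<dots> = det (mat_delete B 0 0)"
    by (simp add: cofactor_def del: sum.lessThan_Suc)
  also have "mat_delete B 0 0 = mat n n (\<lambda>(s, t). x s (Suc t) - u * x s t)"
    by (rule eq_matI) (auto simp: mat_delete_def B_def M_def)
  also have "det M = (\<Sum>t<Suc n. M $$ (0, t) * cofactor M 0 t)"
    by (rule laplace_expansion_row[OF M]) simp
  also have "\<dots> = (\<Sum>t\<le>n. u ^ t * cofactor M 0 t)"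
    by (intro sum.cong) (auto simp: M_def)
  finally show ?thesis by simp
qed

text \<open>\<open>skew_fps j (-1)\<close> subtracts from each entry of the determinant for
  \<open>tl lam\<close> the entry of index one lower, times \<open>fps_X\<close>. By
  \<open>det_column_differences\<close> the coefficients are the first-row cofactors of the
  determinant for \<open>lam\<close>, signs included. Any such \<open>b\<close> serves, since later
  terms vanish.\<close>

lemma schur_bernstein:
  assumes "length lam \<le> b"
  shows "schur (avar j) lam = (\<Sum>i\<le>b. psum_exp 1 (avar j) (first_part lam + i)
    * skew j (-1) i (schur (avar j) (tl lam)))"
proof (cases lam)
  case Nil
  \<comment> \<open>Here \<open>first_part\<close> is 0 and only \<open>i = 0\<close> contributes,
    with \<open>psum_exp\<close> equal to 1.\<close>
  have "schur (avar j) [] = const 1"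
    by (simp add: schur_def det_def)
  moreover have "skew j (-1) i (const 1) = (if i = 0 then const 1 else 0)" for i
    using skew_eq_0[of j 1 i] deriv_var_const[of _ 1] by auto
  ultimately show ?thesis
    by (simp add: Nil first_part_def if_distrib[of "(*) _"] cong: if_cong)
next
  case (Cons m \<mu>)
  define n where "n = length \<mu>"
  interpret fc: comm_ring_hom "fps_const :: V \<Rightarrow> V fps"
    by unfold_locales simp_all
  let ?h = "hom_sym (avar j)"
  define A where "A = mat (Suc n) (Suc n) (\<lambda>(s, t). ?h (int (lam ! s) - int s + int t))"
  \<comment> \<open>Row \<open>s\<close> of \<open>\<mu>\<close> is row \<open>Suc s\<close> of
    \<open>lam\<close>. Column \<open>Suc t\<close> of \<open>x\<close> therefore holds the entry
    for \<open>\<mu>\<close> in column \<open>t\<close>, and column \<open>t\<close> the one of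
    index one lower.\<close>
  define x where "x s t = fps_const (?h (int (\<mu> ! s) - int (Suc s) + int t))" for s t
  define M where "M = mat (Suc n) (Suc n) (\<lambda>(s, t). if s = 0 then fps_X ^ t else x (s - 1) t)"
  have A: "A \<in> carrier_mat (Suc n) (Suc n)" by (simp add: A_def)
  have cof: "cofactor M 0 t = fps_const (cofactor A 0 t)" if "t \<le> n" for t
  proof -
    have "mat_delete M 0 t = map_mat fps_const (mat_delete A 0 t)"
      using that by (intro eq_matI) (auto simp: mat_delete_def M_def A_def x_def Cons)
    then show ?thesis by (simp add: cofactor_def fc.hom_mult fc.hom_power fc.hom_uminus)
  qed
  have "skew_fps j (-1) (schur (avar j) \<mu>)
    = det (mat n n (\<lambda>(s, t). x s (Suc t) - fps_X * x s t))"
    unfolding schur_def skew_fps.hom_det[symmetric]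
    by (intro arg_cong[where f = det] eq_matI)
      (auto simp: skew_fps_hom_sym x_def n_def algebra_simps)
  also have "\<dots> = (\<Sum>t\<le>n. fps_X ^ t * fps_const (cofactor A 0 t))"
    unfolding det_column_differences M_def[symmetric] by (intro sum.cong) (simp_all add: cof)
  finally have "skew j (-1) i (schur (avar j) \<mu>)
      = fps_nth (\<Sum>t\<le>n. fps_X ^ t * fps_const (cofactor A 0 t)) i" for i
    by (metis fps_nth_skew_fps)
  moreover have "fps_nth (fps_X ^ t * fps_const c) i = (if i = t then c else 0)" for t i and c :: V
    by (simp add: fps_X_power_nth)
  ultimately have skew: "skew j (-1) i (schur (avar j) \<mu>) = (if i \<le> n then cofactor A 0 i else 0)" for i
    by (simp add: fps_sum_nth del: fps_mult_right_const_nth)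
  have "schur (avar j) lam = det A"
    by (simp add: schur_def A_def Cons n_def)
  also have "\<dots> = (\<Sum>t<Suc n. A $$ (0, t) * cofactor A 0 t)"
    by (rule laplace_expansion_row[OF A]) simp
  also have "\<dots> = (\<Sum>t\<le>n. psum_exp 1 (avar j) (m + t) * cofactor A 0 t)"
    by (intro sum.cong) (auto simp: A_def Cons simp flip: hom_sym_int)
  also have "\<dots> = (\<Sum>i\<le>b. psum_exp 1 (avar j) (m + i) * skew j (-1) i (schur (avar j) \<mu>))"
    using assms by (intro sum.mono_neutral_cong_left) (auto simp: skew Cons n_def)
  finally show ?thesis by (simp add: Cons first_part_def)
qed

subsection \<open>Sums over subpartitions and paintings\<close>

lemma prod_power_int:
  assumes "(w::'a::field) \<noteq> 0"
  shows "(\<Prod>x\<in>A. w powi f x) = w powi (\<Sum>x\<in>A. f x)"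
  by (induction A rule: infinite_finite_induct) (simp_all add: assms power_int_add)

lemma prod_list_map_nths:
  "prod_list (map f (nths xs S)) = (\<Prod>t\<in>{..<length xs} \<inter> S. f (xs ! t))"
proof -
  have "prod_list (map f (nths xs S)) = (\<Prod>t<length xs. if t \<in> S then f (xs ! t) else 1)"
    by (induction xs arbitrary: S)
      (simp_all add: nths_Cons prod.lessThan_Suc_shift del: prod.lessThan_Suc cong: if_cong)
  then show ?thesis by (simp add: prod.inter_restrict)
qed

lemma sum_list_map_nths:
  "sum_list (map f (nths xs S)) = (\<Sum>t\<in>{..<length xs} \<inter> S. f (xs ! t))"
proof -
  have "sum_list (map f (nths xs S)) = (\<Sum>t<length xs. if t \<in> S then f (xs ! t) else 0)"
    by (induction xs arbitrary: S)
      (simp_all add: nths_Cons sum.lessThan_Suc_shift del: sum.lessThan_Suc cong: if_cong)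
  then show ?thesis by (simp add: sum.inter_restrict)
qed

lemma finite_positions [simp]: "finite (positions k \<rho>)"
  by (simp add: positions_def)

lemma positions_Int: "positions k \<rho> \<inter> A
  = (SIGMA i:{..<k}. {..<length (\<rho> i)} \<inter> {t. (i, t) \<in> A})"
  by (auto simp: positions_def)

text \<open>Turns the product over colors and parts into one over positions, where expansion over
  subsets applies.\<close>

lemma prod_csub: "(\<Prod>i<k. prod_list (map (f i) (csub \<rho> A i)))
  = (\<Prod>(i, t)\<in>positions k \<rho> \<inter> A. f i (\<rho> i ! t))"
  unfolding positions_Int csub_def prod_list_map_nths by (subst prod.Sigma) auto

lemma sum_csub: "(\<Sum>i<k. sum_list (map (f i) (csub \<rho> A i)))
  = (\<Sum>(i, t)\<in>positions k \<rho> \<inter> A. f i (\<rho> i ! t))"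
  unfolding positions_Int csub_def sum_list_map_nths by (subst sum.Sigma) auto

lemma csub_UNIV [simp]: "csub \<rho> UNIV = \<rho>"
  by (simp add: csub_def nths_all)

lemma cdiff_eq_csub: "cdiff \<rho> A = csub \<rho> (- A)"
  by (simp add: cdiff_def csub_def)

lemma weight_csub: "weight k (csub \<rho> A) = (\<Sum>(i, t)\<in>positions k \<rho> \<inter> A. \<rho> i ! t)"
  using sum_csub[where f = "\<lambda>i x. x"] by (simp add: weight_def)

lemma weight_csub_le: "weight k (csub \<rho> A) \<le> weight k \<rho>"
  using weight_csub[of k \<rho> UNIV] by (auto simp: weight_csub intro!: sum_mono2)

lemma \<eta>_csub: "\<eta> k (csub \<rho> A) = (\<Sum>(i, t)\<in>positions k \<rho> \<inter> A. i)"
proof -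
  have "i * length xs = sum_list (map (\<lambda>x. i) xs)" for i :: nat and xs :: "nat list"
    by (simp add: sum_list_triv)
  then show ?thesis
    unfolding \<eta>_def using sum_csub[where f = "\<lambda>i x. i"] by simp
qed

lemma a_tilde_colored_csub: "a_tilde_colored k (csub \<rho> A)
  = (\<Prod>(i, t)\<in>positions k \<rho> \<inter> A. a_tilde k i (\<rho> i ! t))"
  unfolding a_tilde_colored_def prod_csub ..

lemma a_tilde_colored_cunion:
  "a_tilde_colored k (cunion \<mu> \<tau>) = a_tilde_colored k \<mu> * a_tilde_colored k \<tau>"
proof -
  have "prod_list (map f (rev (sort (xs @ ys)))) = prod_list (map f xs) * prod_list (map f ys)"
    for f :: "nat \<Rightarrow> V" and xs ys
    by (metis (no_types, lifting) map_append mset_map mset_rev mset_sort prod_list.append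
        prod_mset_prod_list)
  then show ?thesis
    by (simp add: a_tilde_colored_def cunion_def prod.distrib)
qed

text \<open>With a copy of \<open>\<tau>\<close> in every color, a painting is a choice of
  positions, so the facts about \<open>csub\<close> carry over.\<close>

lemma paint_eq_csub: "paint \<tau> c = csub (\<lambda>_. \<tau>) {(i, t). c t = i}"
  by (simp add: paint_def csub_def)

lemma positions_paint:
  assumes "c \<in> paintings k \<tau>"
  shows "positions k (\<lambda>_. \<tau>) \<inter> {(i, t). c t = i} = (\<lambda>t. (c t, t)) ` {..<length \<tau>}"
  using assms by (auto simp: positions_def paintings_def)

lemma \<eta>_paint: "c \<in> paintings k \<tau> \<Longrightarrow> \<eta> k (paint \<tau> c) = (\<Sum>t<length \<tau>. c t)"
  unfolding paint_eq_csub \<eta>_csub positions_paint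
  by (subst sum.reindex) (auto intro: inj_onI)

lemma clength_paint:
  assumes "c \<in> paintings k \<tau>"
  shows "clength k (paint \<tau> c) = length \<tau>"
proof -
  have "clength k (paint \<tau> c) = (\<Sum>i<k. sum_list (map (\<lambda>_. 1) (paint \<tau> c i)))"
    by (simp add: clength_def sum_list_triv)
  also have "\<dots> = (\<Sum>t<length \<tau>. 1)"
    unfolding paint_eq_csub sum_csub positions_paint[OF assms]
    by (subst sum.reindex) (auto intro: inj_onI)
  finally show ?thesis by simp
qed

lemma a_tilde_colored_paint: "c \<in> paintings k \<tau>
  \<Longrightarrow> a_tilde_colored k (paint \<tau> c) = (\<Prod>t<length \<tau>. a_tilde k (c t) (\<tau> ! t))"
  unfolding paint_eq_csub a_tilde_colored_csub positions_paint
  by (subst prod.reindex) (auto intro: inj_onI)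

section \<open>Roots of unity and Fourier inversion over the colors\<close>

lemma \<omega>_eq_cis: "\<omega> k = cis (2 * pi / real k)"
  by (simp add: \<omega>_def cis_conv_exp mult_ac)

lemma \<omega>_nonzero [simp]: "\<omega> k \<noteq> 0"
  by (simp add: \<omega>_def)

text \<open>A geometric sum whose ratio is a \<open>k\<close>-th root of unity; for
  \<open>l \<noteq> j\<close> the ratio is not 1, because the nonzero number \<open>j - l\<close> is
  smaller than \<open>k\<close> in absolute value.\<close>

lemma sum_\<omega>_power_int:
  assumes "j < k" "l < k"
  shows "(\<Sum>i<k. \<omega> k powi (int i * (int j - int l))) = (if l = j then of_nat k else 0)"
proof (cases "l = j")
  case False
  define d where "d = int j - int l"
  define w where "w = \<omega> k powi d"
  have w: "w = cis (2 * pi * (of_int d / real k))"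
    by (simp add: w_def \<omega>_eq_cis cis_power_int mult_ac)
  have "w \<noteq> 1"
  proof
    assume "w = 1"
    then have "cos (2 * pi * (of_int d / real k)) = 1"
      using w by (metis cis.sel(1) one_complex.sel(1))
    then obtain n :: int where "2 * pi * (of_int d / real k) = of_int n * 2 * pi"
      by (auto simp: cos_one_2pi_int)
    then have "2 * pi * (of_int d / real k) = 2 * pi * of_int n" by (simp only: mult_ac)
    then have "of_int d / real k = of_int n" unfolding mult_cancel_left by simp
    then have "(of_int d :: real) = of_int (n * int k)"
      using assms by (simp add: field_simps)
    then have "int k dvd d" by (metis dvd_triv_right of_int_eq_iff)
    moreover have "d \<noteq> 0" "\<bar>d\<bar> < int k" using assms False by (auto simp: d_def)
    ultimately show False by (metis abs_of_nat zdvd_not_zless dvd_abs_iff abs_ge_zero zero_less_abs_iff)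
  qed
  moreover have "w ^ k = 1"
    using assms cis_multiple_2pi[of "of_int d"] by (simp add: w Complex.DeMoivre)
  moreover have "(\<Sum>i<k. \<omega> k powi (int i * d)) = (\<Sum>i<k. w ^ i)"
    unfolding w_def by (intro sum.cong) (simp_all add: power_int_mult mult.commute)
  ultimately show ?thesis
    using False by (simp add: d_def[symmetric] sum_gp_strict)
qed simp

text \<open>Inversion of the discrete Fourier transform that defines \<open>a_tilde\<close>.\<close>

lemma sum_\<omega>_a_tilde:
  assumes "j < k"
  shows "(\<Sum>i<k. const (\<omega> k powi (int i * int j)) * a_tilde k i r) = of_nat k * avar j r"
proof -
  have split: "\<omega> k powi (int i * (int j - int l))
    = \<omega> k powi (int i * int j) * \<omega> k powi (- (int i * int l))" for i l
    by (subst power_int_add[symmetric]) (simp_all add: right_diff_distrib)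
  have "(\<Sum>i<k. const (\<omega> k powi (int i * int j)) * a_tilde k i r)
    = (\<Sum>i<k. \<Sum>l<k. const (\<omega> k powi (int i * (int j - int l))) * avar l r)"
    unfolding a_tilde_def sum_distrib_left
    by (simp only: split const_mult mult.assoc)
  also have "\<dots> = (\<Sum>l<k. const (\<Sum>i<k. \<omega> k powi (int i * (int j - int l))) * avar l r)"
    by (subst sum.swap) (simp add: const_sum sum_distrib_right)
  also have "\<dots> = (\<Sum>l<k. if l = j then of_nat k * avar j r else 0)"
    using assms by (intro sum.cong refl) (simp add: sum_\<omega>_power_int const_of_nat)
  finally show ?thesis using assms by simp
qed

text \<open>Independent choices of a color for each part expand a product of sums as in
  \<open>sum_\<omega>_a_tilde\<close>, one per part; the denominators cancel the factors
  \<open>k\<close> that inversion produces.\<close>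

lemma sum_paintings:
  assumes "j < k"
  shows "(\<Sum>c\<in>paintings k \<tau>. const (\<omega> k powi (int (\<eta> k (paint \<tau> c)) * int j)
      / of_nat (k ^ clength k (paint \<tau> c))) * a_tilde_colored k (paint \<tau> c))
    = prod_list (map (avar j) \<tau>)"
proof -
  have "(\<Sum>c\<in>paintings k \<tau>. const (\<omega> k powi (int (\<eta> k (paint \<tau> c)) * int j)
      / of_nat (k ^ clength k (paint \<tau> c))) * a_tilde_colored k (paint \<tau> c))
    = const (1 / of_nat (k ^ length \<tau>)) * (\<Sum>c\<in>paintings k \<tau>.
        \<Prod>t<length \<tau>. const (\<omega> k powi (int (c t) * int j)) * a_tilde k (c t) (\<tau> ! t))"
    unfolding sum_distrib_left
  proof (intro sum.cong refl)
    fix c assume c: "c \<in> paintings k \<tau>"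
    have "(\<Prod>t<length \<tau>. const (\<omega> k powi (int (c t) * int j)))
      = const (\<omega> k powi (int (\<eta> k (paint \<tau> c)) * int j))"
      using c by (simp flip: const_prod add: prod_power_int \<eta>_paint sum_distrib_right)
    then show "const (\<omega> k powi (int (\<eta> k (paint \<tau> c)) * int j)
        / of_nat (k ^ clength k (paint \<tau> c))) * a_tilde_colored k (paint \<tau> c)
      = const (1 / of_nat (k ^ length \<tau>)) *
        (\<Prod>t<length \<tau>. const (\<omega> k powi (int (c t) * int j)) * a_tilde k (c t) (\<tau> ! t))"
      using c by (simp add: prod.distrib clength_paint a_tilde_colored_paint
          flip: mult.assoc const_mult)
  qed
  also have "(\<Sum>c\<in>paintings k \<tau>.
        \<Prod>t<length \<tau>. const (\<omega> k powi (int (c t) * int j)) * a_tilde k (c t) (\<tau> ! t))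
    = (\<Prod>t<length \<tau>. of_nat k * avar j (\<tau> ! t))"
    unfolding paintings_def by (subst prod_sum_PiE[symmetric]) (simp_all add: sum_\<omega>_a_tilde assms)
  also have "\<dots> = of_nat (k ^ length \<tau>) * prod_list (map (avar j) \<tau>)"
    using prod_list_map_nths[of "avar j" \<tau> UNIV] by (simp add: prod.distrib nths_all)
  also have "const (1 / of_nat (k ^ length \<tau>)) * \<dots> = prod_list (map (avar j) \<tau>)"
    using assms by (simp add: const_inverse_of_nat del: of_nat_power flip: mult.assoc)
  finally show ?thesis .
qed

text \<open>Only the summand of color \<open>j\<close> is shifted. The shift stands first so that
  \<open>prod_add\<close> later selects it on the subset \<open>A\<close>.\<close>

lemma skew_fps_a_tilde:
  assumes "j < k" "r > 0"
  shows "skew_fps j \<epsilon> (a_tilde k i r) = fps_const (const (\<epsilon> * \<omega> k powi (- (int i * int j)))) * fps_X ^ r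
    + fps_const (a_tilde k i r)"
proof -
  have fps_const_sum: "fps_const (sum f A) = (\<Sum>x\<in>A. fps_const (f x))" for f :: "nat \<Rightarrow> V" and A
    by (induction A rule: infinite_finite_induct) (simp_all flip: fps_const_add)
  have "skew_fps j \<epsilon> (a_tilde k i r)
    = (\<Sum>l<k. fps_const (const (\<omega> k powi (- (int i * int l))) * avar l r)
      + (if l = j then fps_const (const (\<epsilon> * \<omega> k powi (- (int i * int j)))) * fps_X ^ r else 0))"
    unfolding a_tilde_def skew_fps.hom_sum using assms(2)
    by (intro sum.cong refl)
      (auto simp: skew_fps.hom_mult skew_fps_avar distrib_left const_mult mult_ac
        simp flip: fps_const_mult)
  then show ?thesis
    using assms(1) by (simp add: sum.distrib a_tilde_def fps_const_sum)
qed

text \<open>In the expanded product each position contributes either its shift, and then belongs to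
  \<open>A\<close>, or its old factor. The exponents of the shifts add up to the weight of
  \<open>csub \<rho> A\<close>, so the coefficient at \<open>n\<close> singles out that
  weight.\<close>

lemma skew_a_tilde_colored:
  assumes "j < k" and pos: "\<And>i. i < k \<Longrightarrow> 0 \<notin> set (\<rho> i)"
  shows "skew j 1 n (a_tilde_colored k \<rho>)
    = (\<Sum>A | A \<subseteq> positions k \<rho> \<and> weight k (csub \<rho> A) = n.
        const (\<omega> k powi (- (int (\<eta> k (csub \<rho> A)) * int j))) * a_tilde_colored k (cdiff \<rho> A))"
proof -
  interpret fc: comm_ring_hom "fps_const :: V \<Rightarrow> V fps"
    by unfold_locales simp_all
  let ?P = "positions k \<rho>"
  let ?w = "\<lambda>A. const (\<omega> k powi (- (int (\<eta> k (csub \<rho> A)) * int j)))"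
  have "skew_fps j 1 (a_tilde_colored k \<rho>)
    = (\<Prod>(i, t)\<in>?P. skew_fps j 1 (a_tilde k i (\<rho> i ! t)))"
    using a_tilde_colored_csub[of k \<rho> UNIV] by (simp add: skew_fps.hom_prod case_prod_beta)
  also have "\<dots> = (\<Prod>x\<in>?P. (case x of (i, t) \<Rightarrow>
        fps_const (const (\<omega> k powi (- (int i * int j)))) * fps_X ^ (\<rho> i ! t))
      + (case x of (i, t) \<Rightarrow> fps_const (a_tilde k i (\<rho> i ! t))))"
  proof (intro prod.cong refl)
    fix x assume "x \<in> ?P"
    then obtain i t where x: "x = (i, t)" "i < k" "t < length (\<rho> i)"
      by (auto simp: positions_def)
    then have "\<rho> i ! t > 0" using pos[of i] by (metis gr0I nth_mem)
    then show "(case x of (i, t) \<Rightarrow> skew_fps j 1 (a_tilde k i (\<rho> i ! t)))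
      = (case x of (i, t) \<Rightarrow> fps_const (const (\<omega> k powi (- (int i * int j)))) * fps_X ^ (\<rho> i ! t))
      + (case x of (i, t) \<Rightarrow> fps_const (a_tilde k i (\<rho> i ! t)))"
      using skew_fps_a_tilde[OF assms(1), of "\<rho> i ! t" 1 i] x by simp
  qed
  also have "\<dots> = (\<Sum>A\<in>Pow ?P. fps_const (?w A * a_tilde_colored k (cdiff \<rho> A))
      * fps_X ^ weight k (csub \<rho> A))"
    unfolding prod_add[OF finite_positions]
  proof (intro sum.cong refl)
    fix A assume A: "A \<in> Pow ?P"
    then have PA: "?P \<inter> A = A" "?P \<inter> - A = ?P - A" by auto
    have "(\<Prod>(i, t)\<in>A. fps_const (const (\<omega> k powi (- (int i * int j)))) * fps_X ^ (\<rho> i ! t))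
      = fps_const (const (\<Prod>(i, t)\<in>A. \<omega> k powi (- (int i * int j))))
        * fps_X ^ (\<Sum>(i, t)\<in>A. \<rho> i ! t)"
      by (simp add: case_prod_beta prod.distrib const_prod fc.hom_prod power_sum)
    also have "(\<Prod>(i, t)\<in>A. \<omega> k powi (- (int i * int j)))
        = \<omega> k powi (- (int (\<eta> k (csub \<rho> A)) * int j))"
      unfolding \<eta>_csub PA
      by (simp add: case_prod_beta prod_power_int sum_distrib_right sum_negf)
    also have "(\<Sum>(i, t)\<in>A. \<rho> i ! t) = weight k (csub \<rho> A)"
      unfolding weight_csub PA ..
    finally have 1: "(\<Prod>(i, t)\<in>A. fps_const (const (\<omega> k powi (- (int i * int j)))) * fps_X ^ (\<rho> i ! t))
      = fps_const (?w A) * fps_X ^ weight k (csub \<rho> A)" .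
    have 2: "(\<Prod>(i, t)\<in>?P - A. fps_const (a_tilde k i (\<rho> i ! t)))
      = fps_const (a_tilde_colored k (cdiff \<rho> A))"
      unfolding cdiff_eq_csub a_tilde_colored_csub PA by (simp add: case_prod_beta fc.hom_prod)
    show "(\<Prod>(i, t)\<in>A. fps_const (const (\<omega> k powi (- (int i * int j)))) * fps_X ^ (\<rho> i ! t))
        * (\<Prod>(i, t)\<in>?P - A. fps_const (a_tilde k i (\<rho> i ! t)))
      = fps_const (?w A * a_tilde_colored k (cdiff \<rho> A)) * fps_X ^ weight k (csub \<rho> A)"
      unfolding 1 2 by (simp only: fc.hom_mult mult_ac)
  qed
  finally have "skew j 1 n (a_tilde_colored k \<rho>)
    = (\<Sum>A\<in>Pow ?P. if weight k (csub \<rho> A) = n then ?w A * a_tilde_colored k (cdiff \<rho> A) else 0)"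
    by (subst fps_nth_skew_fps[symmetric])
      (auto simp: fps_sum_nth fps_X_power_nth simp del: fps_nth_skew_fps intro!: sum.cong)
  also have "\<dots> = (\<Sum>A | A \<subseteq> ?P \<and> weight k (csub \<rho> A) = n. ?w A * a_tilde_colored k (cdiff \<rho> A))"
    by (simp flip: sum.inter_filter add: Pow_def)
  finally show ?thesis .
qed

text \<open>Derivations in the variables of color \<open>j\<close> annihilate those of color
  \<open>i\<close>, so the homomorphism fixes whatever is built from the latter.\<close>

lemma skew_fps_schur_other_color:
  assumes "i \<noteq> j"
  shows "skew_fps j \<epsilon> (schur (avar i) \<mu>) = fps_const (schur (avar i) \<mu>)"
proof -
  interpret fc: comm_ring_hom "fps_const :: V \<Rightarrow> V fps"
    by unfold_locales simp_all
  have avar: "skew_fps j \<epsilon> (avar i r) = fps_const (avar i r)" for r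
    using assms by (simp add: skew_fps_eq_fps_const deriv_var_avar)
  have "skew_fps j \<epsilon> (hom_sym (avar i) n) = fps_const (hom_sym (avar i) n)" for n
    by (simp add: hom_sym_def skew_fps.hom_sum fc.hom_sum skew_fps.hom_mult skew_fps.hom_prod_list
        fc.hom_prod_list avar o_def flip: fps_const_mult)
  then show ?thesis
    unfolding schur_def skew_fps.hom_det[symmetric] fc.hom_det[symmetric]
    by (intro arg_cong[where f = det] eq_matI) auto
qed

lemma skew_schur_colored:
  assumes "j < k"
  shows "skew j \<epsilon> n (schur_colored k lam)
    = skew j \<epsilon> n (schur (avar j) (lam j)) * (\<Prod>i\<in>{..<k} - {j}. schur (avar i) (lam i))"
proof -
  interpret fc: comm_ring_hom "fps_const :: V \<Rightarrow> V fps"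
    by unfold_locales simp_all
  have "schur_colored k lam = schur (avar j) (lam j) * (\<Prod>i\<in>{..<k} - {j}. schur (avar i) (lam i))"
    unfolding schur_colored_def using assms by (intro prod.remove) auto
  then have "skew_fps j \<epsilon> (schur_colored k lam) = skew_fps j \<epsilon> (schur (avar j) (lam j))
      * fps_const (\<Prod>i\<in>{..<k} - {j}. schur (avar i) (lam i))"
    by (simp add: skew_fps.hom_mult skew_fps.hom_prod skew_fps_schur_other_color fc.hom_prod)
  then have "fps_nth (skew_fps j \<epsilon> (schur_colored k lam)) n = fps_nth (skew_fps j \<epsilon> (schur (avar j) (lam j))
      * fps_const (\<Prod>i\<in>{..<k} - {j}. schur (avar i) (lam i))) n"
    by simp
  then show ?thesis by simp
qed

lemma schur_colored_bernstein:
  assumes "j < k" and "length (lam j) \<le> b"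
  shows "schur_colored k lam = (\<Sum>i\<le>b. psum_exp 1 (avar j) (first_part (lam j) + i)
    * skew j (-1) i (schur_colored k (delete_first lam j)))"
proof -
  have rest: "(\<Prod>i\<in>{..<k} - {j}. schur (avar i) (delete_first lam j i))
    = (\<Prod>i\<in>{..<k} - {j}. schur (avar i) (lam i))"
    by (intro prod.cong) (auto simp: delete_first_def)
  \<comment> \<open>At order 0 skewing is the identity, so this merely splits off the factor of
    color \<open>j\<close>.\<close>
  have "schur_colored k lam
    = schur (avar j) (lam j) * (\<Prod>i\<in>{..<k} - {j}. schur (avar i) (lam i))"
    using skew_schur_colored[OF assms(1), of 1 0] by simp
  then show ?thesis
    unfolding skew_schur_colored[OF assms(1)] rest schur_bernstein[OF assms(2)]
    by (simp add: delete_first_def sum_distrib_right mult.assoc)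
qed

text \<open>\<open>sum_paintings\<close> collapses the paintings of \<open>\<tau>\<close> to power
  sums, which the sign and \<open>z_part\<close> assemble into \<open>psum_exp (-1)\<close>.
  \<open>e\<close> and \<open>\<mu>\<close> are independent here; later \<open>e\<close> is the
  weighted length of the chosen parts, while \<open>\<mu>\<close> consists of the remaining
  ones.\<close>

lemma sum_sum_paintings:
  assumes "j < k"
  shows "(\<Sum>\<tau>\<in>partitions n. \<Sum>c\<in>paintings k \<tau>.
        \<omega> k powi ((int (\<eta> k (paint \<tau> c)) - e) * int j)
        * ((-1) ^ clength k (paint \<tau> c) / of_nat (k ^ clength k (paint \<tau> c) * z_part \<tau>))
        * form f (a_tilde_colored k (cunion \<mu> (paint \<tau> c))))
    = form f (psum_exp (-1) (avar j) n * (const (\<omega> k powi (- (e * int j))) * a_tilde_colored k \<mu>))"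
proof -
  let ?g = "const (\<omega> k powi (- (e * int j))) * a_tilde_colored k \<mu>"
  let ?p = "\<lambda>\<tau> c. const (\<omega> k powi (int (\<eta> k (paint \<tau> c)) * int j)
      / of_nat (k ^ clength k (paint \<tau> c))) * a_tilde_colored k (paint \<tau> c)"
  have "\<omega> k powi ((int (\<eta> k (paint \<tau> c)) - e) * int j)
        * ((-1) ^ clength k (paint \<tau> c) / of_nat (k ^ clength k (paint \<tau> c) * z_part \<tau>))
        * form f (a_tilde_colored k (cunion \<mu> (paint \<tau> c)))
    = form f (const ((-1) ^ length \<tau> / of_nat (z_part \<tau>)) * ?p \<tau> c * ?g)"
    if c: "c \<in> paintings k \<tau>" for \<tau> c
  proof -
    have split: "\<omega> k powi ((int (\<eta> k (paint \<tau> c)) - e) * int j)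
      = \<omega> k powi (int (\<eta> k (paint \<tau> c)) * int j) * \<omega> k powi (- (e * int j))"
      by (subst power_int_add[symmetric]) (simp_all add: left_diff_distrib)
    have "const ((-1) ^ length \<tau> / of_nat (z_part \<tau>)) * ?p \<tau> c * ?g
      = const ((-1) ^ length \<tau> / of_nat (z_part \<tau>) * (\<omega> k powi (int (\<eta> k (paint \<tau> c)) * int j)
          / of_nat (k ^ clength k (paint \<tau> c))) * \<omega> k powi (- (e * int j)))
        * (a_tilde_colored k \<mu> * a_tilde_colored k (paint \<tau> c))"
      by (simp only: const_mult mult_ac)
    then show ?thesis
      by (simp only: form_const_right a_tilde_colored_cunion split clength_paint[OF c]) (simp add: mult_ac)
  qed
  then have "(\<Sum>\<tau>\<in>partitions n. \<Sum>c\<in>paintings k \<tau>.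
        \<omega> k powi ((int (\<eta> k (paint \<tau> c)) - e) * int j)
        * ((-1) ^ clength k (paint \<tau> c) / of_nat (k ^ clength k (paint \<tau> c) * z_part \<tau>))
        * form f (a_tilde_colored k (cunion \<mu> (paint \<tau> c))))
    = (\<Sum>\<tau>\<in>partitions n. \<Sum>c\<in>paintings k \<tau>.
        form f (const ((-1) ^ length \<tau> / of_nat (z_part \<tau>)) * ?p \<tau> c * ?g))"
    by (intro sum.cong refl) blast
  also have "\<dots> = form f ((\<Sum>\<tau>\<in>partitions n.
      const ((-1) ^ length \<tau> / of_nat (z_part \<tau>)) * (\<Sum>c\<in>paintings k \<tau>. ?p \<tau> c)) * ?g)"
    by (simp only: form_sum_right sum_distrib_left sum_distrib_right)
  finally show ?thesis
    unfolding sum_paintings[OF assms] psum_exp_def .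
qed

theorem theorem1p2:
  fixes k n j :: nat and lam \<rho> :: cpart
  assumes "k \<ge> 1" and "n \<ge> 1"
    and "is_cpart k n lam" and "is_cpart k n \<rho>"
    and "j < k"
  shows "\<chi> k lam \<rho> =
    (\<Sum>A | A \<subseteq> positions k \<rho> \<and> weight k (csub \<rho> A) \<ge> first_part (lam j).
      \<Sum>\<tau>\<in>partitions (weight k (csub \<rho> A) - first_part (lam j)).
        \<Sum>c\<in>paintings k \<tau>.
          \<omega> k powi ((int (\<eta> k (paint \<tau> c)) - int (\<eta> k (csub \<rho> A))) * int j)
          * ((-1) ^ clength k (paint \<tau> c) / of_nat (k ^ clength k (paint \<tau> c) * z_part \<tau>))
          * \<chi> k (delete_first lam j) (cunion (cdiff \<rho> A) (paint \<tau> c)))"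
proof -
  define m where "m = first_part (lam j)"
  \<comment> \<open>Large enough for the Bernstein expansion and for every excess of weight over
    \<open>m\<close>, since no subpartition outweighs \<open>\<rho>\<close>.\<close>
  define b where "b = length (lam j) + weight k \<rho>"
  define S where "S = schur_colored k (delete_first lam j)"
  define g where "g A = const (\<omega> k powi (- (int (\<eta> k (csub \<rho> A)) * int j)))
    * a_tilde_colored k (cdiff \<rho> A)" for A
  define P where "P i = {A. A \<subseteq> positions k \<rho> \<and> weight k (csub \<rho> A) = m + i}" for i
  define Q where "Q = {A. A \<subseteq> positions k \<rho> \<and> weight k (csub \<rho> A) \<ge> m}"
  have fin: "finite (P i)" "finite Q" for i
    by (auto simp: P_def Q_def intro: finite_subset[of _ "Pow (positions k \<rho>)"])
  have pos: "0 \<notin> set (\<rho> i)" if "i < k" for i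
    using assms(4) that by (simp add: is_cpart_def is_partition_def)
  have "\<chi> k lam \<rho> = form (\<Sum>i\<le>b. psum_exp 1 (avar j) (m + i) * skew j (-1) i S)
      (a_tilde_colored k \<rho>)"
    unfolding \<chi>_def m_def S_def
    by (subst schur_colored_bernstein[of j k lam b]) (simp_all add: assms(5) b_def)
  \<comment> \<open>\<open>psum_exp 1\<close> crosses the form as \<open>skew j 1\<close>, which
    selects the subpartitions of weight \<open>m + i\<close>.\<close>
  also have "\<dots> = (\<Sum>i\<le>b. form (skew j (-1) i S) (\<Sum>A\<in>P i. g A))"
    by (simp add: form_sum_left form_psum_exp_mult skew_a_tilde_colored[OF assms(5) pos] P_def g_def)
  \<comment> \<open>Adjointness in the reverse direction: skewing of \<open>S\<close> becomes
    multiplication on the right-hand side.\<close>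
  also have "\<dots> = (\<Sum>i\<le>b. \<Sum>A\<in>P i. form S (psum_exp (-1) (avar j) i * g A))"
    unfolding form_sum_right
    by (intro sum.cong refl) (metis form_commute form_psum_exp_mult)
  also have "\<dots> = (\<Sum>(i, A)\<in>Sigma {..b} P. form S (psum_exp (-1) (avar j) i * g A))"
    using fin by (simp add: sum.Sigma)
  \<comment> \<open>\<open>A\<close> determines \<open>i\<close> as its excess weight; the truncated
    subtraction is exact because members of \<open>Q\<close> have weight at least
    \<open>m\<close>.\<close>
  also have "\<dots> = (\<Sum>A\<in>Q. form S (psum_exp (-1) (avar j) (weight k (csub \<rho> A) - m) * g A))"
    by (rule sum.reindex_bij_witness[where j = snd and i = "\<lambda>A. (weight k (csub \<rho> A) - m, A)"])
      (use weight_csub_le[of k \<rho>] in \<open>auto simp: P_def Q_def b_def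
        intro: le_trans[OF diff_le_self] trans_le_add2\<close>)
  also have "\<dots> = (\<Sum>A\<in>Q. \<Sum>\<tau>\<in>partitions (weight k (csub \<rho> A) - m). \<Sum>c\<in>paintings k \<tau>.
        \<omega> k powi ((int (\<eta> k (paint \<tau> c)) - int (\<eta> k (csub \<rho> A))) * int j)
        * ((-1) ^ clength k (paint \<tau> c) / of_nat (k ^ clength k (paint \<tau> c) * z_part \<tau>))
        * form S (a_tilde_colored k (cunion (cdiff \<rho> A) (paint \<tau> c))))"
    unfolding sum_sum_paintings[OF assms(5)] g_def ..
  finally show ?thesis unfolding \<chi>_def S_def Q_def m_def .
qed

end
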